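(* For $n\ge 3$, let $W_n$ be the wheel graph of order $n+1$. Then $sn(W_n)=2$ if $n$ is even, $sn(W_3)=3$, and $sn(W_n)=\frac{n+1}{2}$ if $n\ge 5$ is odd.
   Context: Graphs are finite, undirected and simple. The wheel graph $W_n$, $n\ge 3$, of order $n+1$ is obtained from an $n$-cycle $C_n=v_1v_2\cdots v_nv_1$ by joining a new vertex $u$ to every vertex of $C_n$. Let $G=(V,E)$ be a connected graph with chromatic number $\chi(G)=k\ge 2$. For $S\subset V$, a partial coloring on $G[S]$ is a proper coloring $\mathscr C_0$ of the induced subgraph $G[S]$ with colors from $\{1,\dots,k\}$ (not all colors need be used). It is a Sudoku coloring of $G$ if there is exactly one proper $k$-coloring $V\to\{1,\dots,k\}$ of $G$ whose restriction to $S$ is $\mathscr C_0$. The Sudoku number $sn(G)$ is the smallest $|S|$ such that $G[S]$ admits a Sudoku coloring of $G$. *)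

theory Defs
  imports Main "HOL-Library.FuncSet"
begin

record 'a ugraph =
  verts :: "'a set"
  edges :: "'a set set"

definition simple_graph :: "'a ugraph \<Rightarrow> bool" where
  "simple_graph G \<longleftrightarrow> finite (verts G) \<and> (\<forall>e\<in>edges G. e \<subseteq> verts G \<and> card e = 2)"

definition induced_subgraph :: "'a ugraph \<Rightarrow> 'a set \<Rightarrow> 'a ugraph" where
  "induced_subgraph G S = \<lparr>verts = S, edges = {e \<in> edges G. e \<subseteq> S}\<rparr>"

(* Colorings are extensional functions (undefined outside the vertex set), so that
   equality of colorings, and hence uniqueness, only concerns the vertices. *)
definition proper_coloring :: "'a ugraph \<Rightarrow> nat \<Rightarrow> ('a \<Rightarrow> nat) \<Rightarrow> bool" where
  "proper_coloring G k c \<longleftrightarrow>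
     c \<in> verts G \<rightarrow>\<^sub>E {1..k} \<and>
     (\<forall>u\<in>verts G. \<forall>v\<in>verts G. {u, v} \<in> edges G \<longrightarrow> c u \<noteq> c v)"

definition chromatic_number :: "'a ugraph \<Rightarrow> nat" where
  "chromatic_number G = (LEAST k. \<exists>c. proper_coloring G k c)"

definition partial_coloring :: "'a ugraph \<Rightarrow> 'a set \<Rightarrow> ('a \<Rightarrow> nat) \<Rightarrow> bool" where
  "partial_coloring G S c\<^sub>0 \<longleftrightarrow>
     proper_coloring (induced_subgraph G S) (chromatic_number G) c\<^sub>0"

definition sudoku_coloring :: "'a ugraph \<Rightarrow> 'a set \<Rightarrow> ('a \<Rightarrow> nat) \<Rightarrow> bool" where
  "sudoku_coloring G S c\<^sub>0 \<longleftrightarrow>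
     partial_coloring G S c\<^sub>0 \<and>
     (\<exists>!c. proper_coloring G (chromatic_number G) c \<and> restrict c S = c\<^sub>0)"

definition sudoku_number :: "'a ugraph \<Rightarrow> nat" where
  "sudoku_number G =
     (LEAST s. \<exists>S c\<^sub>0. S \<subseteq> verts G \<and> card S = s \<and> sudoku_coloring G S c\<^sub>0)"

datatype wheel_vertex = Hub | Rim nat

definition wheel :: "nat \<Rightarrow> wheel_vertex ugraph" where
  "wheel n = \<lparr>
     verts = insert Hub (Rim ` {1..n}),
     edges = {{Rim i, Rim (i + 1)} | i. i \<in> {1..<n}} \<union> {{Rim n, Rim 1}}
           \<union> {{Hub, Rim i} | i. i \<in> {1..n}}\<rparr>"

lemma card_verts_wheel: "card (verts (wheel n)) = n + 1"
proof -
  have "inj_on Rim {1..n}"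
    by (simp add: inj_on_def)
  then have "card (Rim ` {1..n}) = n"
    by (simp add: card_image)
  moreover have "Hub \<notin> Rim ` {1..n}"
    by blast
  ultimately show ?thesis
    by (simp add: wheel_def)
qed

lemma simple_graph_wheel:
  assumes "n \<ge> 3"
  shows "simple_graph (wheel n)"
  using assms by (auto simp: simple_graph_def wheel_def card_insert_if)

end

theory Submission imports Defs begin

text \<open>
  Two colors that are both absent from a partial coloring can be interchanged, so a Sudoku coloring
  shows at least \<open>\<chi> - 1\<close> colors; this is sharp for even \<open>n\<close> and for \<open>n = 3\<close>.

  Let \<open>n\<close> be odd, so that \<open>\<chi> = 4\<close>. If two consecutive rim vertices are both uncolored, then any
  extension can be changed on these two vertices alone: let \<open>z\<close> be the color used neither on them
  nor on the hub. Either one of the two can be recolored to \<open>z\<close>, or both outer neighbors have color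
  \<open>z\<close> and the two colors can be swapped. So the colored vertices cover all edges of the odd rim
  cycle, which takes \<open>(n + 1) div 2\<close> of them. Conversely, color the odd rim vertices
  so that all of the colors 1, 2, 3 occur and cyclically consecutive ones differ: the hub must get
  color 4, and each even rim vertex then sees three colors.
\<close>

section \<open>Unique extension of partial colorings in arbitrary graphs\<close>

lemma sudoku_coloring_restrictI:
  assumes "proper_coloring G (chromatic_number G) c" "S \<subseteq> verts G"
    and "\<And>d v. \<lbrakk>proper_coloring G (chromatic_number G) d; \<And>u. u \<in> S \<Longrightarrow> d u = c u; v \<in> verts G\<rbrakk>
           \<Longrightarrow> d v = c v"
  shows "sudoku_coloring G S (restrict c S)"
  unfolding sudoku_coloring_def
proof (intro conjI ex1I)
  show "partial_coloring G S (restrict c S)"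
    using assms(1,2)
    by (auto simp: partial_coloring_def proper_coloring_def induced_subgraph_def PiE_iff subset_iff)
next
  fix d assume d: "proper_coloring G (chromatic_number G) d \<and> restrict d S = restrict c S"
  then have "\<And>u. u \<in> S \<Longrightarrow> d u = c u"
    by (metis restrict_apply')
  then have "\<And>v. v \<in> verts G \<Longrightarrow> d v = c v"
    using d assms(3) by blast
  \<comment> \<open>Both colorings are extensional, so agreement on the vertices already makes them
    equal as functions.\<close>
  moreover have "c \<in> verts G \<rightarrow>\<^sub>E {1..chromatic_number G}"
    "d \<in> verts G \<rightarrow>\<^sub>E {1..chromatic_number G}"
    using d assms(1) by (auto simp: proper_coloring_def)
  ultimately show "d = c" by (metis PiE_ext)
qed (use assms in auto)

text \<open>Puts uniqueness in the form that the lower bounds contradict: they construct a second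
  coloring \<open>d\<close> that agrees with \<open>c\<close> on \<open>S\<close>.\<close>

lemma sudoku_coloring_unique:
  assumes "sudoku_coloring G S c\<^sub>0"
  obtains c where "proper_coloring G (chromatic_number G) c" "restrict c S = c\<^sub>0"
    and "\<And>d. \<lbrakk>proper_coloring G (chromatic_number G) d; \<And>v. v \<in> S \<Longrightarrow> d v = c v\<rbrakk> \<Longrightarrow> d = c"
proof -
  obtain c where c: "proper_coloring G (chromatic_number G) c" "restrict c S = c\<^sub>0"
    and u: "\<And>d. proper_coloring G (chromatic_number G) d \<Longrightarrow> restrict d S = c\<^sub>0 \<Longrightarrow> d = c"
    using assms unfolding sudoku_coloring_def by blast
  have "d = c" if "proper_coloring G (chromatic_number G) d" "\<And>v. v \<in> S \<Longrightarrow> d v = c v" for d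
    using u[OF that(1)] c(2) that(2) restrict_ext by metis
  with c that show ?thesis by blast
qed

text \<open>Otherwise at least two colors are missing on \<open>S\<close>. Interchanging them
  changes the extension if it uses one of them; if it uses neither, a vertex outside
  \<open>S\<close>, which exists because the inclusion is strict, can take one of them.\<close>

lemma chromatic_number_le_Suc_card:
  assumes sud: "sudoku_coloring G S c\<^sub>0" and S: "S \<subset> verts G" and fin: "finite (verts G)"
  shows "chromatic_number G \<le> Suc (card S)"
proof (rule ccontr)
  let ?k = "chromatic_number G"
  assume small: "\<not> ?k \<le> Suc (card S)"
  obtain c where c: "proper_coloring G ?k c"
    and uniq: "\<And>d. \<lbrakk>proper_coloring G ?k d; \<And>v. v \<in> S \<Longrightarrow> d v = c v\<rbrakk> \<Longrightarrow> d = c"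
    using sudoku_coloring_unique[OF sud] by metis
  have "finite S" using S fin finite_subset by blast
  then have "2 \<le> card ({1..?k} - c ` S)"
    using small card_image_le[of S c] diff_card_le_card_Diff[of "c ` S" "{1..?k}"] by simp
  then obtain p q where pq: "p \<in> {1..?k} - c ` S" "q \<in> {1..?k} - c ` S" "p \<noteq> q"
    by (metis One_nat_def Suc_1 card_2_iff' card_le_Suc0_iff_eq finite_Diff finite_atLeastAtMost
        not_less_eq_eq)
  show False
  proof (cases "\<exists>v\<in>verts G. c v = p \<or> c v = q")
    case True
    define d where "d = (\<lambda>v\<in>verts G. if c v = p then q else if c v = q then p else c v)"
    have "d u \<noteq> d v" if "u \<in> verts G" "v \<in> verts G" "{u, v} \<in> edges G" for u v
    proof -
      have "c u \<noteq> c v" using c that by (auto simp: proper_coloring_def)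
      then show ?thesis using that pq(3) by (simp add: d_def)
    qed
    moreover have "d \<in> verts G \<rightarrow>\<^sub>E {1..?k}"
      using c pq by (simp add: proper_coloring_def d_def PiE_iff)
    ultimately have "proper_coloring G ?k d"
      by (simp add: proper_coloring_def)
    moreover have "d v = c v" if "v \<in> S" for v
      using that pq S by (auto simp: d_def)
    ultimately have "d = c" by (rule uniq)
    moreover obtain v where v: "v \<in> verts G" "c v = p \<or> c v = q" using True by blast
    ultimately have "d v = c v" by simp
    then show False using v pq(3) by (auto simp: d_def split: if_splits)
  next
    case False
    obtain v where v: "v \<in> verts G" "v \<notin> S" using S by blast
    \<comment> \<open>Properness of \<open>c\<close> rules out a loop at \<open>v\<close>, so the
      new color \<open>p\<close> is only compared with old colors, none of which is
      \<open>p\<close>.\<close>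
    have "{v, v} \<notin> edges G"
      using c v unfolding proper_coloring_def by blast
    then have "proper_coloring G ?k (c(v := p))"
      using c pq False v by (auto simp: proper_coloring_def PiE_iff extensional_def)
    moreover have "(c(v := p)) u = c u" if "u \<in> S" for u
      using that v by auto
    ultimately have "c(v := p) = c" by (rule uniq)
    then have "c v = p" by (metis fun_upd_same)
    then show False using False v by simp
  qed
qed

section \<open>Proper colorings of wheels\<close>

lemma verts_wheel: "verts (wheel n) = insert Hub (Rim ` {1..n})"
  by (simp add: wheel_def)

lemma finite_verts_wheel: "finite (verts (wheel n))"
  by (simp add: verts_wheel)

lemma proper_coloring_wheel:
  assumes "n \<ge> 3"
  shows "proper_coloring (wheel n) k c \<longleftrightarrow>
    c \<in> verts (wheel n) \<rightarrow>\<^sub>E {1..k} \<and> (\<forall>i\<in>{1..n}. c Hub \<noteq> c (Rim i)) \<and>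
    (\<forall>i\<in>{1..<n}. c (Rim i) \<noteq> c (Rim (i + 1))) \<and> c (Rim n) \<noteq> c (Rim 1)"
    (is "?L \<longleftrightarrow> ?R")
proof
  assume L: ?L
  then have e: "\<And>u v. \<lbrakk>u \<in> verts (wheel n); v \<in> verts (wheel n); {u, v} \<in> edges (wheel n)\<rbrakk>
      \<Longrightarrow> c u \<noteq> c v"
    by (auto simp: proper_coloring_def)
  have "c Hub \<noteq> c (Rim i)" if "i \<in> {1..n}" for i
    using that by (intro e) (auto simp: wheel_def)
  moreover have "c (Rim i) \<noteq> c (Rim (i + 1))" if "i \<in> {1..<n}" for i
    using that by (intro e) (auto simp: wheel_def)
  moreover have "c (Rim n) \<noteq> c (Rim 1)"
    using assms by (intro e) (auto simp: wheel_def)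
  ultimately show ?R using L by (auto simp: proper_coloring_def)
next
  assume ?R
  then show ?L
    by (auto simp: proper_coloring_def wheel_def doubleton_eq_iff) (metis atLeastLessThan_iff)
qed

text \<open>A triangle forces three colors, and when only three are available it determines the
  color of \<open>Rim 2\<close> from those of the hub and \<open>Rim 1\<close>.\<close>

lemma wheel_triangle:
  assumes n: "n \<ge> 3" and c: "proper_coloring (wheel n) k c"
  shows "c (Rim 1) \<noteq> c (Rim 2)" "c Hub \<noteq> c (Rim 1)" "c Hub \<noteq> c (Rim 2)"
proof -
  have "1 \<in> {1..<n}" "1 \<in> {1..n}" "2 \<in> {1..n}" using n by auto
  with c show "c (Rim 1) \<noteq> c (Rim 2)" "c Hub \<noteq> c (Rim 1)" "c Hub \<noteq> c (Rim 2)"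
    unfolding proper_coloring_wheel[OF n] by (metis one_add_one)+
qed

text \<open>The map \<open>i mod n + 1\<close> is the cyclic successor on \<open>{1..n}\<close>;
  with it the closing edge from \<open>Rim n\<close> to \<open>Rim 1\<close> needs no separate
  treatment.\<close>

lemma proper_coloring_wheel_cyclic:
  assumes "n \<ge> 3"
  shows "proper_coloring (wheel n) k c \<longleftrightarrow>
    c \<in> verts (wheel n) \<rightarrow>\<^sub>E {1..k} \<and> (\<forall>i\<in>{1..n}. c Hub \<noteq> c (Rim i)) \<and>
    (\<forall>i\<in>{1..n}. c (Rim i) \<noteq> c (Rim (i mod n + 1)))"
proof -
  have "{1..n} = insert n {1..<n}" using assms by auto
  then show ?thesis
    unfolding proper_coloring_wheel[OF assms] by auto
qed

lemma wheel_color_range: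
  assumes "proper_coloring (wheel n) k c"
  shows "c Hub \<in> {1..k}" and "i \<in> {1..n} \<Longrightarrow> c (Rim i) \<in> {1..k}"
  using assms unfolding proper_coloring_def verts_wheel by (auto simp: PiE_iff)

text \<open>The hub uses up one color, so the rim has only two and must alternate. This propagates
  colors along the rim for even \<open>n\<close> and excludes three colors for odd
  \<open>n\<close>.\<close>

lemma three_coloring_wheel_alternates:
  assumes n: "n \<ge> 3" and c: "proper_coloring (wheel n) k c" and k: "k \<le> 3"
    and i: "i \<in> {1..n}"
  shows "c (Rim i) = c (Rim (if odd i then 1 else 2))"
  using i
proof (induction i rule: less_induct)
  case (less i)
  show ?case
  proof (cases "i \<le> 2")
    case True
    then have "i = 1 \<or> i = 2" using less.prems by auto
    then show ?thesis by auto
  next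
    case False
    define j where "j = i - 2"
    have j: "i = j + 2" "1 \<le> j" "j + 2 \<le> n" using False less.prems by (auto simp: j_def)
    have col: "c Hub \<in> {1..3}" "c (Rim l) \<in> {1..3}" if "l \<in> {1..n}" for l
      using wheel_color_range[OF c] that k by fastforce+
    have "c (Rim j) \<noteq> c (Rim (j + 1))" "c (Rim (j + 1)) \<noteq> c (Rim (j + 2))"
      "c Hub \<noteq> c (Rim j)" "c Hub \<noteq> c (Rim (j + 1))" "c Hub \<noteq> c (Rim (j + 2))"
      using c j unfolding proper_coloring_wheel[OF n] by auto
    \<comment> \<open>Both vertices avoid the two distinct colors of the hub and of
      \<open>Rim (j + 1)\<close>, which leaves one.\<close>
    then have "c (Rim (j + 2)) = c (Rim j)"
      using col[of j] col[of "j + 1"] col[of "j + 2"] j(2,3) by auto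
    moreover have "c (Rim j) = c (Rim (if odd j then 1 else 2))"
      using less.IH[of j] j by auto
    ultimately show ?thesis using j(1) by simp
  qed
qed

section \<open>Explicit colorings and chromatic numbers\<close>

definition even_wheel_coloring :: "nat \<Rightarrow> wheel_vertex \<Rightarrow> nat" where
  "even_wheel_coloring n = (\<lambda>v\<in>verts (wheel n).
     case v of Hub \<Rightarrow> 3 | Rim i \<Rightarrow> if odd i then 1 else 2)"

text \<open>The odd rim vertices 1, 3, 5, 7, ... get 3, 1, 2, 1, ..., alternating between 1 and 2
  from \<open>Rim 3\<close> on. Each even one gets the color in 1, 2, 3 that its two neighbors
  leave: 2 at \<open>Rim 2\<close>, and 3 afterwards.\<close>

definition odd_wheel_coloring :: "nat \<Rightarrow> wheel_vertex \<Rightarrow> nat" where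
  "odd_wheel_coloring n = (\<lambda>v\<in>verts (wheel n).
     case v of Hub \<Rightarrow> 4 | Rim i \<Rightarrow>
       if i = 1 then 3 else if i = 2 then 2 else
       if even i then 3 else if i mod 4 = 3 then 1 else 2)"

lemma odd_wheel_coloring_simps:
  "odd_wheel_coloring n Hub = 4"
  "i \<in> {1..n} \<Longrightarrow> odd_wheel_coloring n (Rim i) =
      (if i = 1 then 3 else if i = 2 then 2 else
       if even i then 3 else if i mod 4 = 3 then 1 else 2)"
  by (auto simp: odd_wheel_coloring_def verts_wheel)

lemma proper_even_wheel_coloring:
  assumes "n \<ge> 3" "even n"
  shows "proper_coloring (wheel n) 3 (even_wheel_coloring n)"
  unfolding proper_coloring_wheel[OF assms(1)] using assms
  by (auto simp: even_wheel_coloring_def verts_wheel)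

lemma proper_odd_wheel_coloring:
  assumes "n \<ge> 3" "odd n"
  shows "proper_coloring (wheel n) 4 (odd_wheel_coloring n)"
  unfolding proper_coloring_wheel[OF assms(1)]
proof (intro conjI ballI)
  show "odd_wheel_coloring n \<in> verts (wheel n) \<rightarrow>\<^sub>E {1..4}"
    by (auto simp: odd_wheel_coloring_def verts_wheel)
  show "odd_wheel_coloring n Hub \<noteq> odd_wheel_coloring n (Rim i)" if "i \<in> {1..n}" for i
    using that by (simp add: odd_wheel_coloring_simps)
  show "odd_wheel_coloring n (Rim n) \<noteq> odd_wheel_coloring n (Rim 1)"
    using assms by (simp add: odd_wheel_coloring_simps)
  show "odd_wheel_coloring n (Rim i) \<noteq> odd_wheel_coloring n (Rim (i + 1))" if "i \<in> {1..<n}" for i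
    using that by (cases "i = 1 \<or> i = 2") (auto simp: odd_wheel_coloring_simps)
qed

lemma chromatic_number_even_wheel:
  assumes n: "n \<ge> 3" and "even n"
  shows "chromatic_number (wheel n) = 3"
  unfolding chromatic_number_def
proof (rule Least_equality)
  show "\<exists>c. proper_coloring (wheel n) 3 c"
    using proper_even_wheel_coloring[OF assms] by blast
next
  fix k assume "\<exists>c. proper_coloring (wheel n) k c"
  then obtain c where c: "proper_coloring (wheel n) k c" by blast
  show "3 \<le> k"
    using wheel_triangle[OF n c] wheel_color_range(1)[OF c] wheel_color_range(2)[OF c, of 1]
      wheel_color_range(2)[OF c, of 2] n by auto
qed

lemma chromatic_number_odd_wheel:
  assumes n: "n \<ge> 3" and odd: "odd n"
  shows "chromatic_number (wheel n) = 4"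
  unfolding chromatic_number_def
proof (rule Least_equality)
  show "\<exists>c. proper_coloring (wheel n) 4 c"
    using proper_odd_wheel_coloring[OF assms] by blast
next
  fix k assume "\<exists>c. proper_coloring (wheel n) k c"
  then obtain c where c: "proper_coloring (wheel n) k c" by blast
  have "c (Rim n) \<noteq> c (Rim 1)"
    using c unfolding proper_coloring_wheel[OF n] by blast
  \<comment> \<open>Alternation gives \<open>Rim n\<close> the color of \<open>Rim 1\<close> because
    \<open>n\<close> is odd, against the closing edge.\<close>
  then have "\<not> k \<le> 3"
    using three_coloring_wheel_alternates[OF n c, of n] n odd by auto
  then show "4 \<le> k" by simp
qed

section \<open>Rim edges and the lower bound for odd wheels\<close>

lemma inj_on_rim_succ: "inj_on (\<lambda>i. i mod n + 1) {1..n :: nat}"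
proof (rule inj_onI)
  fix i j assume "i \<in> {1..n}" "j \<in> {1..n}" "i mod n + 1 = j mod n + 1"
  then show "i = j" by (cases "i = n"; cases "j = n") auto
qed

text \<open>Four colors leave enough freedom to change a coloring on the two ends of any single rim
  edge, so such an edge must meet the colored set.\<close>

lemma wheel_recolor_edge:
  assumes n: "n \<ge> 3" and c: "proper_coloring (wheel n) 4 c" and i: "i \<in> {1..n}"
  obtains d where "proper_coloring (wheel n) 4 d" "d \<noteq> c"
    and "\<And>v. v \<noteq> Rim i \<Longrightarrow> v \<noteq> Rim (i mod n + 1) \<Longrightarrow> d v = c v"
proof -
  define s where "s = (\<lambda>i. i mod n + 1)"
  have s_in: "s l \<in> {1..n}" for l
    using n by (simp add: s_def Suc_le_eq)
  have s_inj: "l = m" if "s l = s m" "l \<in> {1..n}" "m \<in> {1..n}" for l m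
    using inj_onD[OF inj_on_rim_succ] that unfolding s_def by blast
  \<comment> \<open>Since \<open>n \<ge> 3\<close>, the outer neighbors of a rim edge differ from
    its ends; for \<open>n = 3\<close> they coincide with each other.\<close>
  have s_neq: "s l \<noteq> l" "s (s l) \<noteq> l" if "l \<in> {1..n}" for l
    using that n by (cases "l = n"; cases "l + 1 = n"; auto simp: s_def)+
  have proper: "proper_coloring (wheel n) 4 d \<longleftrightarrow> d \<in> verts (wheel n) \<rightarrow>\<^sub>E {1..4} \<and>
      (\<forall>i\<in>{1..n}. d Hub \<noteq> d (Rim i)) \<and> (\<forall>i\<in>{1..n}. d (Rim i) \<noteq> d (Rim (s i)))" for d
    using proper_coloring_wheel_cyclic[OF n] unfolding s_def .
  note cP = c[unfolded proper]
  define j where "j = s i"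
  have j: "j \<in> {1..n}" "j \<noteq> i" "s j \<noteq> j" "s j \<noteq> i"
    using s_in s_neq i by (auto simp: j_def)
  have "\<not> {1..4} \<subseteq> {c Hub, c (Rim i), c (Rim j)}"
  proof
    assume "{1..4} \<subseteq> {c Hub, c (Rim i), c (Rim j)}"
    from card_mono[OF _ this] show False
      using card_length[of "[c Hub, c (Rim i), c (Rim j)]"] by simp
  qed
  then obtain z where z: "z \<in> {1..4}" "z \<noteq> c Hub" "z \<noteq> c (Rim i)" "z \<noteq> c (Rim j)"
    by blast
  have hub: "c Hub \<noteq> c (Rim l)" if "l \<in> {1..n}" for l using cP that by blast
  have rim: "c (Rim l) \<noteq> c (Rim (s l))" if "l \<in> {1..n}" for l using cP that by blast
  have ext: "c(Rim l := y) \<in> verts (wheel n) \<rightarrow>\<^sub>E {1..4}"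
    if "l \<in> {1..n}" "y \<in> {1..4}" "c \<in> verts (wheel n) \<rightarrow>\<^sub>E {1..4}"
    for l y and c :: "wheel_vertex \<Rightarrow> nat"
    using that by (auto simp: verts_wheel PiE_iff extensional_def)
  \<comment> \<open>The outer neighbor of \<open>i\<close> is its predecessor, that of
    \<open>j\<close> is \<open>s j\<close>. Either \<open>z\<close> is admissible at
    \<open>i\<close>, or at \<open>j\<close>, or both outer neighbors have color
    \<open>z\<close>.\<close>
  consider "\<And>l. l \<in> {1..n} \<Longrightarrow> s l = i \<Longrightarrow> c (Rim l) \<noteq> z" | "c (Rim (s j)) \<noteq> z"
    | p where "p \<in> {1..n}" "s p = i" "c (Rim p) = z" "c (Rim (s j)) = z"
    by blast
  then show ?thesis
  proof cases
    case 1
    have "proper_coloring (wheel n) 4 (c(Rim i := z))"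
      unfolding proper using 1 z hub rim ext[OF i z(1)] cP s_neq(1)[OF i] by (auto simp: j_def)
    moreover have "c(Rim i := z) \<noteq> c" using z by (metis fun_upd_same)
    ultimately show ?thesis using that by fastforce
  next
    case 2
    have "l = i" if "l \<in> {1..n}" "s l = j" for l
      using s_inj that i by (simp add: j_def)
    then have "proper_coloring (wheel n) 4 (c(Rim j := z))"
      unfolding proper using 2 z hub rim ext[OF j(1) z(1)] cP by auto
    moreover have "c(Rim j := z) \<noteq> c" using z by (metis fun_upd_same)
    ultimately show ?thesis using that unfolding j_def s_def by fastforce
  next
    case 3
    \<comment> \<open>Both outer neighbors have color \<open>z\<close>, which is neither of the two
      swapped colors, so the swap creates no conflict with them.\<close>
    let ?d = "c(Rim i := c (Rim j), Rim j := c (Rim i))"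
    have ij: "c (Rim i) \<noteq> c (Rim j)" using rim i by (simp add: j_def)
    have "?d \<in> verts (wheel n) \<rightarrow>\<^sub>E {1..4}"
      by (intro ext i j(1) wheel_color_range(2)[OF c] conjunct1[OF cP])
    moreover have "?d Hub \<noteq> ?d (Rim l)" if "l \<in> {1..n}" for l
      using hub that i j(1) by auto
    moreover have "?d (Rim l) \<noteq> ?d (Rim (s l))" if l: "l \<in> {1..n}" for l
    proof -
      have "s l = i \<Longrightarrow> l = p" "s l = j \<Longrightarrow> l = i"
        using s_inj l 3 i by (auto simp: j_def)
      then show ?thesis
        using rim[OF l] 3 z ij j by (auto simp: j_def)
    qed
    ultimately have "proper_coloring (wheel n) 4 ?d"
      unfolding proper by blast
    moreover have "?d \<noteq> c" using ij by (metis fun_upd_same)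
    ultimately show ?thesis using that unfolding j_def s_def by fastforce
  qed
qed

text \<open>Rim edges are indexed by their first end. \<open>A\<close> collects those whose first
  end lies in \<open>S\<close>, \<open>B\<close> those whose second end does; each injects into
  \<open>S\<close>, and together they contain all \<open>n\<close> edges.\<close>

lemma card_rim_edge_cover:
  assumes "finite S"
    and cover: "\<And>i. i \<in> {1..n} \<Longrightarrow> Rim i \<in> S \<or> Rim (i mod n + 1) \<in> S"
  shows "n \<le> 2 * card S"
proof -
  define A where "A = {i \<in> {1..n}. Rim i \<in> S}"
  define B where "B = {i \<in> {1..n}. Rim (i mod n + 1) \<in> S}"
  have "card A \<le> card S"
    using assms(1) by (intro card_inj_on_le[of Rim]) (auto simp: A_def inj_on_def)
  moreover have "inj_on (\<lambda>i. Rim (i mod n + 1)) B"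
  proof (rule inj_onI)
    fix i j assume "i \<in> B" "j \<in> B" "Rim (i mod n + 1) = Rim (j mod n + 1)"
    then show "i = j"
      by (intro inj_on_rim_succ[THEN inj_onD, of i n j]) (simp_all add: B_def)
  qed
  then have "card B \<le> card S"
    using assms(1) by (intro card_inj_on_le[of "\<lambda>i. Rim (i mod n + 1)"]) (auto simp: B_def)
  moreover have "{1..n} \<subseteq> A \<union> B"
    using cover unfolding A_def B_def by blast
  then have "card {1..n} \<le> card (A \<union> B)"
    by (intro card_mono) (auto simp: A_def B_def)
  ultimately show ?thesis
    using card_Un_le[of A B] by simp
qed

lemma sudoku_coloring_odd_wheel_card:
  assumes n: "n \<ge> 3" and odd: "odd n"
    and S: "S \<subseteq> verts (wheel n)" and sud: "sudoku_coloring (wheel n) S c\<^sub>0"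
  shows "(n + 1) div 2 \<le> card S"
proof -
  obtain c where c: "proper_coloring (wheel n) 4 c"
    and uniq: "\<And>d. \<lbrakk>proper_coloring (wheel n) 4 d; \<And>v. v \<in> S \<Longrightarrow> d v = c v\<rbrakk> \<Longrightarrow> d = c"
    using sudoku_coloring_unique[OF sud] unfolding chromatic_number_odd_wheel[OF n odd] by metis
  have "Rim i \<in> S \<or> Rim (i mod n + 1) \<in> S" if "i \<in> {1..n}" for i
    using wheel_recolor_edge[OF n c that] uniq by metis
  then have "n \<le> 2 * card S"
    using card_rim_edge_cover finite_subset[OF S finite_verts_wheel] by blast
  then show ?thesis using odd by presburger
qed

section \<open>Sudoku numbers of wheels\<close>

lemma sudoku_numberI:
  assumes "S \<subseteq> verts G" "card S = s" "sudoku_coloring G S c\<^sub>0"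
    and "\<And>T d. \<lbrakk>T \<subseteq> verts G; sudoku_coloring G T d\<rbrakk> \<Longrightarrow> s \<le> card T"
  shows "sudoku_number G = s"
  unfolding sudoku_number_def using assms by (intro Least_equality) blast+

text \<open>The general bound covers proper subsets only; the full vertex set has
  \<open>n + 1\<close> elements, which is enough as at most four colors are involved.\<close>

lemma sudoku_coloring_wheel_card:
  assumes n: "n \<ge> 3" and T: "T \<subseteq> verts (wheel n)" and sud: "sudoku_coloring (wheel n) T d"
    and k: "chromatic_number (wheel n) \<le> 4"
  shows "chromatic_number (wheel n) - 1 \<le> card T"
proof (cases "T = verts (wheel n)")
  case True
  then show ?thesis using card_verts_wheel n k by simp
next
  case False
  then have "T \<subset> verts (wheel n)" using T by blast
  then show ?thesis
    using chromatic_number_le_Suc_card[OF sud _ finite_verts_wheel] by simp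
qed

text \<open>Coloring the hub and \<open>Rim 1\<close> suffices: the triangle fixes
  \<open>Rim 2\<close>, and alternation fixes the rest of the rim.\<close>

lemma sudoku_number_even_wheel:
  assumes n: "n \<ge> 3" and even: "even n"
  shows "sudoku_number (wheel n) = 2"
proof (rule sudoku_numberI)
  note chi = chromatic_number_even_wheel[OF assms]
  let ?c = "even_wheel_coloring n"
  show S: "{Hub, Rim 1} \<subseteq> verts (wheel n)"
    using n by (auto simp: verts_wheel)
  show "card {Hub, Rim 1} = 2" by simp
  show "sudoku_coloring (wheel n) {Hub, Rim 1} (restrict ?c {Hub, Rim 1})"
  proof (rule sudoku_coloring_restrictI[OF _ S], unfold chi)
    show "proper_coloring (wheel n) 3 ?c"
      using proper_even_wheel_coloring[OF assms] .
    fix d v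
    assume d: "proper_coloring (wheel n) 3 d" "\<And>u. u \<in> {Hub, Rim 1} \<Longrightarrow> d u = ?c u"
      and v: "v \<in> verts (wheel n)"
    have d1: "d Hub = 3" "d (Rim 1) = 1"
      using d(2)[of Hub] d(2)[of "Rim 1"] n by (simp_all add: even_wheel_coloring_def verts_wheel)
    have d2: "d (Rim 2) = 2"
      using wheel_triangle[OF n d(1)] d1 wheel_color_range(2)[OF d(1), of 2] n by auto
    show "d v = ?c v"
    proof (cases v)
      case Hub
      then show ?thesis using d(2) by simp
    next
      case (Rim i)
      then have "i \<in> {1..n}" using v by (auto simp: verts_wheel)
      then have "d (Rim i) = (if odd i then 1 else 2)"
        using three_coloring_wheel_alternates[OF n d(1) order_refl, of i] d1 d2
        by (auto split: if_splits)
      then show ?thesis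
        using Rim v by (simp add: even_wheel_coloring_def)
    qed
  qed
  fix T d assume "T \<subseteq> verts (wheel n)" "sudoku_coloring (wheel n) T d"
  then show "2 \<le> card T"
    using sudoku_coloring_wheel_card[OF n, of T d] chi by simp
qed

lemma odd_wheel_hub_color:
  assumes n: "n \<ge> 3" and d: "proper_coloring (wheel n) 4 d"
    and "i \<in> {1..n}" "j \<in> {1..n}" "l \<in> {1..n}"
    and "d (Rim i) = 1" "d (Rim j) = 2" "d (Rim l) = 3"
  shows "d Hub = 4"
proof -
  have "d Hub \<noteq> d (Rim i)" "d Hub \<noteq> d (Rim j)" "d Hub \<noteq> d (Rim l)"
    using d assms(3-5) unfolding proper_coloring_wheel[OF n] by auto
  then show ?thesis using wheel_color_range(1)[OF d] assms(6-8) by auto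
qed

text \<open>This wheel is the complete graph on four vertices. The bound from missing colors gives
  3, more than the 2 from covering rim edges, and the whole rim attains it.\<close>

lemma sudoku_number_wheel_3: "sudoku_number (wheel 3) = 3"
proof (rule sudoku_numberI)
  have chi: "chromatic_number (wheel 3) = 4"
    by (rule chromatic_number_odd_wheel) auto
  let ?c = "odd_wheel_coloring 3" and ?S = "Rim ` {1..3}"
  show S: "?S \<subseteq> verts (wheel 3)"
    by (auto simp: verts_wheel)
  show "card ?S = 3" by (simp add: card_image inj_on_def)
  show "sudoku_coloring (wheel 3) ?S (restrict ?c ?S)"
  proof (rule sudoku_coloring_restrictI[OF _ S], unfold chi)
    show "proper_coloring (wheel 3) 4 ?c"
      by (rule proper_odd_wheel_coloring) auto
    fix d v
    assume d: "proper_coloring (wheel 3) 4 d" "\<And>u. u \<in> ?S \<Longrightarrow> d u = ?c u"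
      and v: "v \<in> verts (wheel 3)"
    have "d Hub = 4"
      using d(2)[of "Rim 1"] d(2)[of "Rim 2"] d(2)[of "Rim 3"]
      by (intro odd_wheel_hub_color[OF _ d(1), of 3 2 1]) (simp_all add: odd_wheel_coloring_simps)
    then show "d v = ?c v"
      using v d(2) by (auto simp: verts_wheel odd_wheel_coloring_simps(1))
  qed
  fix T d assume "T \<subseteq> verts (wheel 3)" "sudoku_coloring (wheel 3) T d"
  then show "3 \<le> card T"
    using sudoku_coloring_wheel_card[of 3 T d] chi by simp
qed

lemma sudoku_number_odd_wheel:
  assumes n: "n \<ge> 5" and odd: "odd n"
  shows "sudoku_number (wheel n) = (n + 1) div 2"
proof (rule sudoku_numberI)
  have n3: "n \<ge> 3" using n by simp
  note chi = chromatic_number_odd_wheel[OF n3 odd]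
  let ?c = "odd_wheel_coloring n"
  \<comment> \<open>As \<open>n\<close> is odd, the indices \<open>2 * j + 1\<close> run through 1,
    3, ..., \<open>n\<close>.\<close>
  define S where "S = (\<lambda>j. Rim (2 * j + 1)) ` {..<(n + 1) div 2}"
  have S_iff: "Rim i \<in> S \<longleftrightarrow> i \<in> {1..n} \<and> odd i" for i
  proof
    assume "Rim i \<in> S"
    then show "i \<in> {1..n} \<and> odd i" by (auto simp: S_def)
  next
    assume "i \<in> {1..n} \<and> odd i"
    then show "Rim i \<in> S"
      by (auto simp: S_def elim!: oddE)
  qed
  show S: "S \<subseteq> verts (wheel n)"
    by (auto simp: S_def verts_wheel)
  show "card S = (n + 1) div 2"
    unfolding S_def by (subst card_image) (auto simp: inj_on_def)
  show "sudoku_coloring (wheel n) S (restrict ?c S)"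
  proof (rule sudoku_coloring_restrictI[OF _ S], unfold chi)
    show c: "proper_coloring (wheel n) 4 ?c"
      using proper_odd_wheel_coloring[OF n3 odd] .
    fix d v
    assume d: "proper_coloring (wheel n) 4 d" "\<And>u. u \<in> S \<Longrightarrow> d u = ?c u"
      and v: "v \<in> verts (wheel n)"
    have d_odd: "d (Rim i) = ?c (Rim i)" if "i \<in> {1..n}" "odd i" for i
      using d(2) S_iff that by blast
    \<comment> \<open>\<open>Rim 3\<close>, \<open>Rim 5\<close> and \<open>Rim 1\<close> show the
      colors 1, 2 and 3; \<open>n \<ge> 5\<close> guarantees that \<open>Rim 5\<close>
      exists.\<close>
    have hub: "d Hub = 4"
      using d_odd[of 1] d_odd[of 3] d_odd[of 5] n
      by (intro odd_wheel_hub_color[OF n3 d(1), of 3 5 1]) (simp_all add: odd_wheel_coloring_simps)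
    show "d v = ?c v"
    proof (cases v)
      case Hub
      then show ?thesis using hub by (simp add: odd_wheel_coloring_simps)
    next
      case (Rim i)
      then have i: "i \<in> {1..n}" using v by (auto simp: verts_wheel)
      show ?thesis
      proof (cases "odd i")
        case True
        then show ?thesis using d_odd i Rim by simp
      next
        case False
        \<comment> \<open>For even \<open>i\<close> and odd \<open>n\<close> the neighbors
          \<open>l\<close> and \<open>l + 2\<close> of \<open>i\<close> on the rim involve no
          wrap-around, and both are colored.\<close>
        define l where "l = i - 1"
        have l: "i = l + 1" "odd l" "1 \<le> l" "l + 2 \<le> n"
          using False i odd by (auto simp: l_def elim!: evenE oddE)
        \<comment> \<open>Stated for any coloring \<open>e\<close>, to be used for both
          \<open>d\<close> and \<open>?c\<close>: they avoid the same three colors at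
          \<open>Rim i\<close> and hence agree there.\<close>
        have seen: "e Hub \<noteq> e (Rim i)" "e (Rim l) \<noteq> e (Rim i)" "e (Rim i) \<noteq> e (Rim (l + 2))"
          "e (Rim i) \<in> {1..4}"
          if "proper_coloring (wheel n) 4 e" for e
          using that l wheel_color_range(2)[OF that i] unfolding proper_coloring_wheel[OF n3] by auto
        have same: "d (Rim l) = ?c (Rim l)" "d (Rim (l + 2)) = ?c (Rim (l + 2))" "d Hub = ?c Hub"
          using d_odd l hub by (auto simp: odd_wheel_coloring_simps(1))
        \<comment> \<open>The residue selects 1 or 2, except that \<open>Rim 1\<close> has color 3,
          which also differs from the 1 at \<open>Rim 3\<close>.\<close>
        have "l mod 4 = 1 \<and> (l + 2) mod 4 = 3 \<or> l mod 4 = 3 \<and> (l + 2) mod 4 = 1"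
          using l(2) by presburger
        then have "?c (Rim l) \<noteq> ?c (Rim (l + 2))"
          using l by (auto simp: odd_wheel_coloring_simps(2))
        moreover have "?c (Rim l) \<in> {1..3}" "?c (Rim (l + 2)) \<in> {1..3}" "?c Hub = 4"
          using l by (auto simp: odd_wheel_coloring_simps)
        ultimately have "d (Rim i) = ?c (Rim i)"
          using seen[OF d(1)] seen[OF c] same by auto
        then show ?thesis using Rim by simp
      qed
    qed
  qed
  fix T d assume "T \<subseteq> verts (wheel n)" "sudoku_coloring (wheel n) T d"
  then show "(n + 1) div 2 \<le> card T"
    using sudoku_coloring_odd_wheel_card[OF n3 odd] by blast
qed

theorem theorem3p14:
  fixes n :: nat
  assumes "n \<ge> 3"
  shows "(even n \<longrightarrow> sudoku_number (wheel n) = 2) \<and>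
         sudoku_number (wheel 3) = 3 \<and>
         (odd n \<and> n \<ge> 5 \<longrightarrow> sudoku_number (wheel n) = (n + 1) div 2)"
  using assms sudoku_number_even_wheel sudoku_number_wheel_3 sudoku_number_odd_wheel by blast

end
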